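(* For every integer $a\ge 2$ and every real number $b\in(1,a)$ there exist an integer $N$ and an infinite sequence $\omega$ over an $a$-letter alphabet such that for every $n\ge N$, any two different occurrences in $\omega$ of the same substring (factor) of length $n$ are at distance at least $b^n$ from each other.
   Context: An occurrence of a string $u$ of length $n$ in $\omega=\omega_0\omega_1\ldots$ is a position $i$ with $\omega_i\omega_{i+1}\cdots\omega_{i+n-1}=u$; the distance between occurrences at positions $i$ and $j$ is $|i-j|$. *)

theory Defs
  imports Complex_Main
begin

definition occurrence :: "(nat \<Rightarrow> 'a) \<Rightarrow> 'a list \<Rightarrow> nat \<Rightarrow> bool" where
  "occurrence \<omega> u i \<longleftrightarrow> map \<omega> [i..<i + length u] = u"

definition occurrence_dist :: "nat \<Rightarrow> nat \<Rightarrow> real" where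
  "occurrence_dist i j = \<bar>real i - real j\<bar>"

end

theory Submission
  imports Defs "HOL-Library.Sublist"
begin

text \<open>
  Call a finite word good if no factor of length \<open>n \<ge> N\<close> recurs at a distance below \<open>b ^ n\<close>, and
  let \<open>C L\<close> be the number of good words of length \<open>L\<close>. Fix \<open>\<beta>\<close> with \<open>b < \<beta> < a\<close>. If appending a
  letter to a good word of length \<open>L\<close> makes it bad, then a suffix of some length \<open>n \<ge> N\<close> repeats
  at some distance \<open>d < b ^ n\<close>, and for given \<open>n\<close> and \<open>d\<close> the new word is determined by its good
  prefix of length \<open>L + 1 - n\<close>. So at most \<open>\<Sum>n\<ge>N. b ^ n * C (L + 1 - n)\<close> extensions are bad.
  Inductively \<open>C (L + 1 - n) \<le> C L / \<beta> ^ (n - 1)\<close>, and this bounds the sum by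
  \<open>\<beta> * (\<Sum>n\<ge>N. (b / \<beta>) ^ n) * C L \<le> (a - \<beta>) * C L\<close> for large \<open>N\<close>; hence
  \<open>C (L + 1) \<ge> \<beta> * C L\<close>. Good words of every length exist, and compactness gives an infinite one.
\<close>

section \<open>Compactness: from finite words to an infinite one\<close>

lemma koenig_words:
  assumes "finite A"
    and words: "\<And>w. w \<in> T \<Longrightarrow> set w \<subseteq> A"
    and closed: "\<And>v w. w \<in> T \<Longrightarrow> prefix v w \<Longrightarrow> v \<in> T"
    and "infinite T"
  shows "\<exists>\<omega>. range \<omega> \<subseteq> A \<and> (\<forall>n. map \<omega> [0..<n] \<in> T)"
proof -
  \<comment> \<open>Koenig's argument: a \<open>big\<close> word has infinitely many extensions in
    \<open>T\<close>. All but the word itself pass through one of finitely many one-letter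
    extensions, so one of these is \<open>big\<close> again.\<close>
  define big where "big w \<longleftrightarrow> infinite {v \<in> T. prefix w v}" for w
  have step: "\<exists>c. c \<in> A \<and> big (w @ [c])" if "big w" for w
  proof (rule ccontr)
    assume "\<not> ?thesis"
    then have fin: "finite (\<Union>c\<in>A. {v \<in> T. prefix (w @ [c]) v})"
      using \<open>finite A\<close> by (auto simp: big_def)
    have "{v \<in> T. prefix w v} \<subseteq> {w} \<union> (\<Union>c\<in>A. {v \<in> T. prefix (w @ [c]) v})"
    proof
      fix v assume v: "v \<in> {v \<in> T. prefix w v}"
      then obtain x where x: "v = w @ x" by (auto elim: prefixE)
      show "v \<in> {w} \<union> (\<Union>c\<in>A. {v \<in> T. prefix (w @ [c]) v})"
      proof (cases x)
        case (Cons c y)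
        then have "c \<in> A" using v x words by fastforce
        then show ?thesis using v x Cons by auto
      qed (use x in auto)
    qed
    moreover have "finite ({w} \<union> (\<Union>c\<in>A. {v \<in> T. prefix (w @ [c]) v}))"
      using fin by simp
    ultimately show False using that unfolding big_def by (blast dest: finite_subset)
  qed
  \<comment> \<open>\<open>f\<close> and \<open>\<omega>\<close> make the same choice, so
    \<open>f n\<close> is the prefix of \<open>\<omega>\<close> of length \<open>n\<close>.\<close>
  define f where "f = rec_nat [] (\<lambda>_ w. w @ [SOME c. c \<in> A \<and> big (w @ [c])])"
  define \<omega> where "\<omega> n = (SOME c. c \<in> A \<and> big (f n @ [c]))" for n
  have f0: "f 0 = []" and fS: "f (Suc n) = f n @ [\<omega> n]" for n
    by (simp_all add: f_def \<omega>_def)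
  have big: "big (f n)" for n
  proof (induction n)
    case 0
    show ?case using \<open>infinite T\<close> by (simp add: f0 big_def)
  next
    case (Suc n)
    then show ?case unfolding fS \<omega>_def by (rule someI_ex[OF step, THEN conjunct2])
  qed
  have mem: "\<omega> n \<in> A" for n
    unfolding \<omega>_def by (rule someI_ex[OF step[OF big], THEN conjunct1])
  have "f n \<in> T" for n
  proof -
    have "{v \<in> T. prefix (f n) v} \<noteq> {}"
      using big[of n] unfolding big_def by (rule infinite_imp_nonempty)
    then show ?thesis using closed by blast
  qed
  moreover have "map \<omega> [0..<n] = f n" for n
    by (induction n) (simp_all add: f0 fS)
  ultimately show ?thesis using mem by (intro exI[of _ \<omega>]) auto
qed

section \<open>Finite words without close repeats\<close>

definition good :: "real \<Rightarrow> nat \<Rightarrow> 'a list \<Rightarrow> bool" where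
  "good b N w \<longleftrightarrow> (\<forall>n d i. N \<le> n \<longrightarrow> 0 < d \<longrightarrow> real d < b ^ n \<longrightarrow> i + d + n \<le> length w \<longrightarrow>
     (\<exists>k<n. w ! (i + k) \<noteq> w ! (i + d + k)))"

definition good_words :: "nat \<Rightarrow> real \<Rightarrow> nat \<Rightarrow> nat \<Rightarrow> nat list set" where
  "good_words a b N L = {w. set w \<subseteq> {..<a} \<and> length w = L \<and> good b N w}"

lemma good_prefix:
  assumes "good b N w" "prefix v w"
  shows "good b N v"
  unfolding good_def
proof (intro allI impI)
  fix n d i assume h: "N \<le> n" "0 < d" "real d < b ^ n" "i + d + n \<le> length v"
  obtain x where x: "w = v @ x" using assms(2) by (auto elim: prefixE)
  then have "i + d + n \<le> length w" using h by simp
  then obtain k where k: "k < n" "w ! (i + k) \<noteq> w ! (i + d + k)"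
    using assms(1) h unfolding good_def by blast
  then have "v ! (i + k) \<noteq> v ! (i + d + k)"
    using x h by (simp add: nth_append)
  then show "\<exists>k<n. v ! (i + k) \<noteq> v ! (i + d + k)" using k by blast
qed

lemma finite_good_words: "finite (good_words a b N L)"
  by (rule finite_subset[OF _ finite_lists_length_eq[of "{..<a}" L]]) (auto simp: good_words_def)

lemma take_good_words:
  assumes "w \<in> good_words a b N L" "m \<le> L"
  shows "take m w \<in> good_words a b N m"
proof -
  have w: "set w \<subseteq> {..<a}" "length w = L" "good b N w"
    using assms(1) by (simp_all add: good_words_def)
  have "good b N (take m w)" using w(3) take_is_prefix by (rule good_prefix)
  moreover have "set (take m w) \<subseteq> {..<a}" using w(1) set_take_subset by (rule subset_trans[rotated])
  ultimately show ?thesis using w(2) assms(2) by (simp add: good_words_def)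
qed

text \<open>The one-letter extensions that a repeat of length \<open>n\<close> at shift
  \<open>d\<close> can spoil. The bound on \<open>d + n\<close> keeps the truncated subtraction
  \<open>k - d\<close> exact.\<close>

definition repeat_words :: "nat \<Rightarrow> real \<Rightarrow> nat \<Rightarrow> nat \<Rightarrow> nat \<Rightarrow> nat \<Rightarrow> nat list set" where
  "repeat_words a b N L n d = {v. length v = Suc L \<and> take L v \<in> good_words a b N L \<and> d + n \<le> Suc L \<and>
     (\<forall>k. Suc L - n \<le> k \<longrightarrow> k \<le> L \<longrightarrow> v ! k = v ! (k - d))}"

text \<open>Every letter of the repeated suffix copies the one \<open>d\<close> places before it, so
  the part before the suffix determines the word: cutting the suffix off is injective.\<close>

lemma card_repeat_words:
  assumes "0 < d" "0 < n"
  shows "finite (repeat_words a b N L n d)"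
    and "card (repeat_words a b N L n d) \<le> card (good_words a b N (Suc L - n))"
proof -
  have inj: "inj_on (take (Suc L - n)) (repeat_words a b N L n d)"
  proof (rule inj_onI)
    fix u v
    assume u: "u \<in> repeat_words a b N L n d" and v: "v \<in> repeat_words a b N L n d"
      and eq: "take (Suc L - n) u = take (Suc L - n) v"
    \<comment> \<open>Strong induction, because the two copies overlap when \<open>d < n\<close>:
      position \<open>k - d\<close> may lie in the suffix too.\<close>
    have "k \<le> L \<Longrightarrow> u ! k = v ! k" for k
    proof (induction k rule: less_induct)
      case (less k)
      show ?case
      proof (cases "k < Suc L - n")
        case True
        then show ?thesis using eq by (metis nth_take)
      next
        case False
        have "d + n \<le> Suc L" using u by (simp add: repeat_words_def)
        then have "k - d < k" using False assms by linarith
        then have "u ! (k - d) = v ! (k - d)" using less by simp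
        then show ?thesis using u v False less.prems by (simp add: repeat_words_def)
      qed
    qed
    then show "u = v"
      using u v by (intro nth_equalityI) (auto simp: repeat_words_def)
  qed
  have sub: "take (Suc L - n) ` repeat_words a b N L n d \<subseteq> good_words a b N (Suc L - n)"
  proof (intro image_subsetI)
    fix v assume "v \<in> repeat_words a b N L n d"
    then have "take L v \<in> good_words a b N L" by (simp add: repeat_words_def)
    from take_good_words[OF this, of "Suc L - n"]
    show "take (Suc L - n) v \<in> good_words a b N (Suc L - n)"
      using assms(2) by (simp add: min_absorb1)
  qed
  show "finite (repeat_words a b N L n d)"
    using inj_on_finite[OF inj sub finite_good_words] .
  show "card (repeat_words a b N L n d) \<le> card (good_words a b N (Suc L - n))"
    using card_inj_on_le[OF inj sub finite_good_words] .
qed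

section \<open>Growth of the number of good words\<close>

lemma card_pos_less:
  assumes "0 \<le> x"
  shows "finite {d::nat. 0 < d \<and> real d < x}" "real (card {d::nat. 0 < d \<and> real d < x}) \<le> x"
proof -
  have sub: "{d::nat. 0 < d \<and> real d < x} \<subseteq> {1..nat \<lfloor>x\<rfloor>}"
    by (auto simp: le_nat_floor)
  then show "finite {d::nat. 0 < d \<and> real d < x}" by (rule finite_subset) simp
  have "card {d::nat. 0 < d \<and> real d < x} \<le> nat \<lfloor>x\<rfloor>"
    using card_mono[OF _ sub] by simp
  then show "real (card {d::nat. 0 < d \<and> real d < x}) \<le> x"
    using assms by linarith
qed

text \<open>Each one-letter extension of a good word is good or lies in some
  \<open>repeat_words\<close>. The union bound finishes, as at most \<open>b ^ n\<close> shifts are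
  possible for length \<open>n\<close>.\<close>

lemma card_good_words_Suc:
  fixes b :: real
  assumes "0 < b" "1 \<le> N"
  shows "real a * card (good_words a b N L)
    \<le> card (good_words a b N (Suc L)) + (\<Sum>n=N..Suc L. b ^ n * card (good_words a b N (Suc L - n)))"
proof -
  let ?C = "\<lambda>m. card (good_words a b N m)"
  define D where "D n = {d::nat. 0 < d \<and> real d < b ^ n}" for n
  have D: "finite (D n)" "real (card (D n)) \<le> b ^ n" for n
    using card_pos_less[of "b ^ n"] assms(1) by (simp_all add: D_def)
  define E where "E = (\<lambda>(w, c). w @ [c]) ` (good_words a b N L \<times> {..<a})"
  let ?R = "\<Union>n\<in>{N..Suc L}. \<Union>d\<in>D n. repeat_words a b N L n d"
  have cardE: "card E = a * ?C L"
    unfolding E_def by (subst card_image) (auto simp: inj_on_def card_cartesian_product)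
  have sub: "E \<subseteq> good_words a b N (Suc L) \<union> ?R"
  proof
    fix v assume v: "v \<in> E"
    then obtain w c where w: "v = w @ [c]" "w \<in> good_words a b N L" "c < a"
      by (auto simp: E_def)
    then have len: "length w = L" by (simp add: good_words_def)
    show "v \<in> good_words a b N (Suc L) \<union> ?R"
    proof (cases "good b N v")
      case True
      then show ?thesis using w by (auto simp: good_words_def)
    next
      case False
      then obtain n d i where h: "N \<le> n" "0 < d" "real d < b ^ n" "i + d + n \<le> Suc L"
        and rep: "\<And>k. k < n \<Longrightarrow> v ! (i + k) = v ! (i + d + k)"
        using w(1) len unfolding good_def by (simp, blast)
      \<comment> \<open>The repeat must use the new letter; otherwise it would lie inside the good
        word \<open>w\<close>.\<close>
      have "i + d + n = Suc L"
      proof (rule ccontr)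
        assume "i + d + n \<noteq> Suc L"
        then have le: "i + d + n \<le> L" using h by simp
        then obtain k where "k < n" "w ! (i + k) \<noteq> w ! (i + d + k)"
          using w(2) len h unfolding good_words_def good_def by blast
        then show False using rep[of k] w(1) len le by (simp add: nth_append)
      qed
      moreover have "v ! k = v ! (k - d)" if "Suc L - n \<le> k" "k \<le> L" for k
      proof -
        have "k - (i + d) < n" "i + (k - (i + d)) = k - d" "i + d + (k - (i + d)) = k"
          using that calculation by linarith+
        then show ?thesis using rep[of "k - (i + d)"] by simp
      qed
      ultimately have "v \<in> repeat_words a b N L n d"
        using w len by (auto simp: repeat_words_def)
      then show ?thesis using h v by (auto simp: D_def)
    qed
  qed
  have "card ?R \<le> (\<Sum>n=N..Suc L. card (\<Union>d\<in>D n. repeat_words a b N L n d))"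
    by (rule card_UN_le) simp
  also have "\<dots> \<le> (\<Sum>n=N..Suc L. card (D n) * ?C (Suc L - n))"
  proof (rule sum_mono)
    fix n assume "n \<in> {N..Suc L}"
    then have n: "0 < n" using assms(2) by simp
    have "card (\<Union>d\<in>D n. repeat_words a b N L n d) \<le> (\<Sum>d\<in>D n. card (repeat_words a b N L n d))"
      by (rule card_UN_le) (rule D)
    also have "\<dots> \<le> (\<Sum>d\<in>D n. ?C (Suc L - n))"
      using n by (intro sum_mono card_repeat_words) (auto simp: D_def)
    finally show "card (\<Union>d\<in>D n. repeat_words a b N L n d) \<le> card (D n) * ?C (Suc L - n)"
      by simp
  qed
  finally have "real (card ?R) \<le> real (\<Sum>n=N..Suc L. card (D n) * ?C (Suc L - n))"
    by (rule of_nat_mono)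
  also have "\<dots> = (\<Sum>n=N..Suc L. real (card (D n)) * ?C (Suc L - n))"
    by simp
  also have "\<dots> \<le> (\<Sum>n=N..Suc L. b ^ n * ?C (Suc L - n))"
    by (intro sum_mono mult_right_mono D) simp
  finally have R: "real (card ?R) \<le> (\<Sum>n=N..Suc L. b ^ n * ?C (Suc L - n))" .
  have "finite ?R"
    using assms(2) by (intro finite_UN_I D card_repeat_words) (auto simp: D_def)
  then have "card E \<le> card (good_words a b N (Suc L) \<union> ?R)"
    using sub by (intro card_mono) (simp_all add: finite_good_words)
  also have "\<dots> \<le> ?C (Suc L) + card ?R"
    by (rule card_Un_le)
  finally have "real (a * ?C L) \<le> real (?C (Suc L) + card ?R)"
    unfolding cardE by (rule of_nat_mono)
  then show ?thesis using R by simp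
qed

lemma sum_power_le:
  fixes q :: real
  assumes "0 \<le> q" "q < 1"
  shows "(\<Sum>n=m..k. q ^ n) \<le> q ^ m / (1 - q)"
proof -
  have "(1 - q) * (\<Sum>n=m..k. q ^ n) \<le> q ^ m"
    using assms by (cases "m \<le> k") (simp_all add: sum_gp_multiplied)
  then show ?thesis using assms by (simp add: pos_le_divide_eq mult.commute)
qed

text \<open>The hypothesis on \<open>N\<close> says that a geometric tail, which bounds the fraction
  of extensions lost, is at most \<open>a - \<beta>\<close>. The recursion reaches back to all
  shorter lengths, hence strong induction.\<close>

lemma card_good_words_growth:
  assumes b: "0 < b" and "b < \<beta>" "1 \<le> N"
    and N: "\<beta> * (b / \<beta>) ^ N / (1 - b / \<beta>) \<le> real a - \<beta>"
  shows "\<beta> * card (good_words a b N L) \<le> card (good_words a b N (Suc L))"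
proof (induction L rule: less_induct)
  case (less L)
  let ?C = "\<lambda>m. real (card (good_words a b N m))"
  let ?q = "b / \<beta>"
  have \<beta>: "0 < \<beta>" and q: "0 < ?q" "?q < 1" using assms by auto
  \<comment> \<open>The induction hypothesis applied at \<open>m\<close> successive lengths.\<close>
  have mono: "m \<le> L \<Longrightarrow> \<beta> ^ m * ?C (L - m) \<le> ?C L" for m
  proof (induction m)
    case (Suc m)
    have "\<beta> ^ m * (\<beta> * ?C (L - Suc m)) \<le> \<beta> ^ m * ?C (L - m)"
      using less[of "L - Suc m"] Suc.prems \<beta> by (intro mult_left_mono) (simp_all add: Suc_diff_Suc)
    then show ?case using Suc by (simp add: mult_ac)
  qed simp
  have "(\<Sum>n=N..Suc L. b ^ n * ?C (Suc L - n)) \<le> (\<Sum>n=N..Suc L. \<beta> * ?q ^ n * ?C L)"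
  proof (rule sum_mono)
    fix n assume n: "n \<in> {N..Suc L}"
    \<comment> \<open>\<open>Suc L - n\<close> is only \<open>n - 1\<close> below \<open>L\<close>,
      so \<open>mono\<close> gains one power of \<open>\<beta>\<close> less than \<open>n\<close>;
      this is the extra factor \<open>\<beta>\<close> in the bound.\<close>
    with \<open>1 \<le> N\<close> obtain m where m: "n = Suc m" by (cases n) auto
    have "b ^ n * ?C (Suc L - n) = \<beta> * ?q ^ n * (\<beta> ^ m * ?C (L - m))"
      using \<beta> by (simp add: m power_divide)
    also have "\<dots> \<le> \<beta> * ?q ^ n * ?C L"
      using mono[of m] n m \<beta> b by (intro mult_left_mono) auto
    finally show "b ^ n * ?C (Suc L - n) \<le> \<beta> * ?q ^ n * ?C L" .
  qed
  also have "\<dots> = \<beta> * (\<Sum>n=N..Suc L. ?q ^ n) * ?C L"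
    by (simp only: sum_distrib_left sum_distrib_right)
  also have "\<dots> \<le> \<beta> * (?q ^ N / (1 - ?q)) * ?C L"
  proof (intro mult_right_mono mult_left_mono)
    show "(\<Sum>n=N..Suc L. ?q ^ n) \<le> ?q ^ N / (1 - ?q)"
      using q by (intro sum_power_le) auto
  qed (use \<beta> in auto)
  also have "\<dots> \<le> (real a - \<beta>) * ?C L"
    using N by (intro mult_right_mono) simp_all
  finally have "(\<Sum>n=N..Suc L. b ^ n * ?C (Suc L - n)) \<le> (real a - \<beta>) * ?C L" .
  then show ?case
    using card_good_words_Suc[OF b \<open>1 \<le> N\<close>, of a L] by (simp add: algebra_simps)
qed

lemma good_words_nonempty:
  assumes "1 < b" "b < real a"
  shows "\<exists>N. \<forall>L. good_words a b N L \<noteq> {}"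
proof -
  \<comment> \<open>Above \<open>b\<close>, so that the ratio \<open>b / \<beta>\<close> is below 1;
    below \<open>a\<close>, so that the tail, which tends to 0, drops under the positive slack
    \<open>a - \<beta>\<close>.\<close>
  obtain \<beta> where \<beta>: "b < \<beta>" "\<beta> < real a" using dense[OF assms(2)] by blast
  let ?q = "b / \<beta>"
  have q: "0 < ?q" "?q < 1" using assms \<beta> by auto
  have "(\<lambda>N. \<beta> * ?q ^ N / (1 - ?q)) \<longlonglongrightarrow> \<beta> * 0 / (1 - ?q)"
    using q by (intro tendsto_intros LIMSEQ_power_zero) auto
  then have "eventually (\<lambda>N. \<beta> * ?q ^ N / (1 - ?q) < real a - \<beta>) sequentially"
    by (rule order_tendstoD) (use \<beta> in simp)
  then have "eventually (\<lambda>N. 1 \<le> N \<and> \<beta> * ?q ^ N / (1 - ?q) < real a - \<beta>) sequentially"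
    using eventually_ge_at_top by (rule eventually_conj[rotated])
  then obtain N where N: "1 \<le> N" "\<beta> * ?q ^ N / (1 - ?q) < real a - \<beta>"
    using eventually_happens[of _ sequentially] by auto
  have "0 < card (good_words a b N L)" for L
  proof (induction L)
    case 0
    have "good_words a b N 0 = {[]}" by (auto simp: good_words_def good_def)
    then show ?case by simp
  next
    case (Suc L)
    then have "0 < \<beta> * card (good_words a b N L)" using assms \<beta> by simp
    also have "\<dots> \<le> card (good_words a b N (Suc L))"
      using N assms \<beta> by (intro card_good_words_growth) auto
    finally show ?case by simp
  qed
  then show ?thesis by (metis card.empty less_irrefl)
qed

section \<open>The infinite sequence\<close>

lemma occurrence_iff:
  "occurrence \<omega> u i \<longleftrightarrow> (\<forall>k<length u. \<omega> (i + k) = u ! k)"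
  unfolding occurrence_def list_eq_iff_nth_eq[of "map _ _"] by simp

theorem theorem3:
  fixes a :: nat and b :: real
  assumes "a \<ge> 2" and "1 < b" and "b < real a"
  shows "\<exists>(N::nat) (\<omega>::nat \<Rightarrow> nat). range \<omega> \<subseteq> {..<a} \<and>
    (\<forall>n\<ge>N. \<forall>u. length u = n \<longrightarrow>
      (\<forall>i j. occurrence \<omega> u i \<and> occurrence \<omega> u j \<and> i \<noteq> j \<longrightarrow>
        occurrence_dist i j \<ge> b ^ n))"
proof -
  obtain N where ne: "\<And>L. good_words a b N L \<noteq> {}"
    using good_words_nonempty[OF assms(2,3)] by blast
  define T where "T = {w. set w \<subseteq> {..<a} \<and> good b N w}"
  have "\<exists>\<omega>. range \<omega> \<subseteq> {..<a} \<and> (\<forall>n. map \<omega> [0..<n] \<in> T)"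
  proof (rule koenig_words)
    show "v \<in> T" if "w \<in> T" "prefix v w" for v w
      using that good_prefix set_mono_prefix unfolding T_def by blast
    \<comment> \<open>\<open>T\<close> is infinite because it contains words of every
      length.\<close>
    have "length ` T = UNIV"
    proof (intro equalityI subset_UNIV subsetI)
      fix L
      obtain w where "w \<in> good_words a b N L" using ne by blast
      then have "w \<in> T" "L = length w" by (auto simp: T_def good_words_def)
      then show "L \<in> length ` T" by blast
    qed
    then show "infinite T"
      using finite_imageI infinite_UNIV_nat by metis
  qed (auto simp: T_def)
  then obtain \<omega> where \<omega>: "range \<omega> \<subseteq> {..<a}" "\<And>n. good b N (map \<omega> [0..<n])"
    by (auto simp: T_def)
  have far: "b ^ length u \<le> real j - real i"
    if N: "N \<le> length u" and occ: "occurrence \<omega> u i" "occurrence \<omega> u j" and "i < j" for u i j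
  proof (rule ccontr)
    assume "\<not> ?thesis"
    then have "real (j - i) < b ^ length u" using \<open>i < j\<close> by (simp add: of_nat_diff)
    \<comment> \<open>The prefix of length \<open>j + length u\<close> contains both occurrences;
      its goodness is used with shift \<open>j - i\<close>.\<close>
    moreover have "0 < j - i" and "i + (j - i) + length u \<le> length (map \<omega> [0..<j + length u])"
      using \<open>i < j\<close> by simp_all
    ultimately obtain k where "k < length u"
      "map \<omega> [0..<j + length u] ! (i + k) \<noteq> map \<omega> [0..<j + length u] ! (i + (j - i) + k)"
      using \<omega>(2)[of "j + length u", unfolded good_def, rule_format, OF N] by blast
    then show False using occ \<open>i < j\<close> by (simp add: occurrence_iff)
  qed
  have "b ^ length u \<le> occurrence_dist i j"
    if "N \<le> length u" "occurrence \<omega> u i" "occurrence \<omega> u j" "i \<noteq> j" for u i j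
    using that far[of u i j] far[of u j i] unfolding occurrence_dist_def
    by (cases i j rule: linorder_cases) auto
  then show ?thesis using \<omega>(1) by blast
qed

end
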